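(* Let $M$ be a graded quasi-primaryful $R$-module. Then for every graded submodule $K$ of $M$, $$\varphi(qp\text{-}V_M^g(K))=V_{\overline R}^g\big(\overline{Gr((K:_RM))}\big)$$ and $$\varphi\big(qp.Spec_g(M)\setminus qp\text{-}V_M^g(K)\big)=Spec_g(\overline R)\setminus V_{\overline R}^g\big(\overline{Gr((K:_RM))}\big);$$ i.e., $\varphi$ is both closed and open.
   Context: $R=\bigoplus_{g\in G}R_g$ is a graded commutative ring with identity graded by a group $G$, $h(R)=\bigcup_g R_g$; $M$ is a graded $R$-module, $h(M)$ its homogeneous elements. $Gr(I)$ is the graded radical of a graded ideal $I$. $Spec_g(R)$: graded prime ideals. $(K:_RM)=\{r: rM\subseteq K\}$. Graded prime submodule: proper graded $P$ with $rm\in P$ ($r\in h(R), m\in h(M)$) implying $m\in P$ or $r\in(P:_RM)$. $Gr_M(K)$: intersection of graded prime submodules containing $K$ ($M$ if none). Graded primeful property of $K$: for each graded prime $p\supseteq(K:_RM)$ there is a graded prime submodule $P\supseteq K$ with $(P:_RM)=p$. Graded quasi-primary submodule: proper graded $Q$ with $rm\in Q$ ($r\in h(R),m\in h(M)$) implying $r\in Gr((Q:_RM))$ or $m\in Gr_M(Q)$. $qp.Spec_g(M)$: graded quasi-primary submodules with the graded primeful property. $qp\text{-}V_M^g(K)=\{Q\in qp.Spec_g(M): Gr((Q:_RM))\supseteq Gr((K:_RM))\}$; these are the closed sets of the quasi-Zariski topology. $\overline R=R/\mathrm{Ann}(M)$, $\overline I=I/\mathrm{Ann}(M)$; $V_{\overline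 R}^g(\overline I)$ is the set of graded prime ideals of $\overline R$ containing $\overline I$ (Zariski closed sets of $Spec_g(\overline R)$). Natural map $\varphi:qp.Spec_g(M)\to Spec_g(\overline R)$, $\varphi(Q)=\overline{(Gr_M(Q):_RM)}=\overline{Gr((Q:_RM))}$. A graded quasi-primary ideal of $R$ is a proper graded ideal $q$ with $ab\in q$ ($a,b\in h(R)$) implying $a\in Gr(q)$ or $b\in Gr(q)$. $M$ is graded quasi-primaryful if $M=0$, or $M\neq0$ and for every graded quasi-primary ideal $q$ of $R$ containing $\mathrm{Ann}(M)$ there exists $Q\in qp.Spec_g(M)$ with $Gr((Q:_RM))=Gr(q)$. *)

theory Defs
  imports "HOL-Algebra.Algebra"
begin

text \<open>Gradings are indexed by a group, rendered as a type 'g of class group_add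
  (the group operation is written +).  Rings and modules are HOL-Algebra
  structures; a grading is a function from 'g to subsets of the carrier.\<close>

definition homog :: "('g \<Rightarrow> 'a set) \<Rightarrow> 'a set" where
  "homog gr = (\<Union>g. gr g)"

definition graded_ring :: "('a, 'c) ring_scheme \<Rightarrow> ('g::group_add \<Rightarrow> 'a set) \<Rightarrow> bool" where
  "graded_ring R gR \<longleftrightarrow> cring R \<and>
     (\<forall>g. additive_subgroup (gR g) R) \<and>
     (\<forall>g h. \<forall>a\<in>gR g. \<forall>b\<in>gR h. a \<otimes>\<^bsub>R\<^esub> b \<in> gR (g + h)) \<and>
     (\<forall>x\<in>carrier R. \<exists>!c. (\<forall>g. c g \<in> gR g) \<and> finite {g. c g \<noteq> \<zero>\<^bsub>R\<^esub>} \<and>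
                          x = finsum R c {g. c g \<noteq> \<zero>\<^bsub>R\<^esub>})"

definition hcomp :: "('a, 'c) ring_scheme \<Rightarrow> ('g \<Rightarrow> 'a set) \<Rightarrow> 'a \<Rightarrow> 'g \<Rightarrow> 'a" where
  "hcomp R gR x = (THE c. (\<forall>g. c g \<in> gR g) \<and> finite {g. c g \<noteq> \<zero>\<^bsub>R\<^esub>} \<and>
                          x = finsum R c {g. c g \<noteq> \<zero>\<^bsub>R\<^esub>})"

definition graded_ideal :: "('a, 'c) ring_scheme \<Rightarrow> ('g \<Rightarrow> 'a set) \<Rightarrow> 'a set \<Rightarrow> bool" where
  "graded_ideal R gR I \<longleftrightarrow> ideal I R \<and>
     (\<forall>x\<in>I. \<exists>S c. finite S \<and> (\<forall>g\<in>S. c g \<in> I \<inter> gR g) \<and> x = finsum R c S)"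

definition graded_prime_ideal :: "('a, 'c) ring_scheme \<Rightarrow> ('g \<Rightarrow> 'a set) \<Rightarrow> 'a set \<Rightarrow> bool" where
  "graded_prime_ideal R gR p \<longleftrightarrow> graded_ideal R gR p \<and> p \<noteq> carrier R \<and>
     (\<forall>a\<in>homog gR. \<forall>b\<in>homog gR. a \<otimes>\<^bsub>R\<^esub> b \<in> p \<longrightarrow> a \<in> p \<or> b \<in> p)"

definition Spec_g :: "('a, 'c) ring_scheme \<Rightarrow> ('g \<Rightarrow> 'a set) \<Rightarrow> 'a set set" where
  "Spec_g R gR = {p. graded_prime_ideal R gR p}"

definition V_g :: "('a, 'c) ring_scheme \<Rightarrow> ('g \<Rightarrow> 'a set) \<Rightarrow> 'a set \<Rightarrow> 'a set set" where
  "V_g R gR I = {p \<in> Spec_g R gR. I \<subseteq> p}"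

definition Gr :: "('a, 'c) ring_scheme \<Rightarrow> ('g \<Rightarrow> 'a set) \<Rightarrow> 'a set \<Rightarrow> 'a set" where
  "Gr R gR I = {x \<in> carrier R. \<forall>g. \<exists>n::nat. n > 0 \<and> (hcomp R gR x g) [^]\<^bsub>R\<^esub> n \<in> I}"

definition graded_quasi_primary_ideal :: "('a, 'c) ring_scheme \<Rightarrow> ('g \<Rightarrow> 'a set) \<Rightarrow> 'a set \<Rightarrow> bool" where
  "graded_quasi_primary_ideal R gR q \<longleftrightarrow> graded_ideal R gR q \<and> q \<noteq> carrier R \<and>
     (\<forall>a\<in>homog gR. \<forall>b\<in>homog gR. a \<otimes>\<^bsub>R\<^esub> b \<in> q \<longrightarrow> a \<in> Gr R gR q \<or> b \<in> Gr R gR q)"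

definition graded_module ::
  "('a, 'c) ring_scheme \<Rightarrow> ('g::group_add \<Rightarrow> 'a set) \<Rightarrow> ('a, 'b) module \<Rightarrow> ('g \<Rightarrow> 'b set) \<Rightarrow> bool" where
  "graded_module R gR M gM \<longleftrightarrow> module R M \<and>
     (\<forall>g. additive_subgroup (gM g) M) \<and>
     (\<forall>g h. \<forall>a\<in>gR g. \<forall>m\<in>gM h. a \<odot>\<^bsub>M\<^esub> m \<in> gM (g + h)) \<and>
     (\<forall>x\<in>carrier M. \<exists>!c. (\<forall>g. c g \<in> gM g) \<and> finite {g. c g \<noteq> \<zero>\<^bsub>M\<^esub>} \<and>
                          x = finsum M c {g. c g \<noteq> \<zero>\<^bsub>M\<^esub>})"

definition graded_submodule ::
  "('a, 'c) ring_scheme \<Rightarrow> ('a, 'b) module \<Rightarrow> ('g \<Rightarrow> 'b set) \<Rightarrow> 'b set \<Rightarrow> bool" where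
  "graded_submodule R M gM K \<longleftrightarrow> submodule K R M \<and>
     (\<forall>x\<in>K. \<exists>S c. finite S \<and> (\<forall>g\<in>S. c g \<in> K \<inter> gM g) \<and> x = finsum M c S)"

definition colon :: "('a, 'c) ring_scheme \<Rightarrow> ('a, 'b) module \<Rightarrow> 'b set \<Rightarrow> 'a set" where
  "colon R M K = {r \<in> carrier R. \<forall>m\<in>carrier M. r \<odot>\<^bsub>M\<^esub> m \<in> K}"

definition Ann :: "('a, 'c) ring_scheme \<Rightarrow> ('a, 'b) module \<Rightarrow> 'a set" where
  "Ann R M = {r \<in> carrier R. \<forall>m\<in>carrier M. r \<odot>\<^bsub>M\<^esub> m = \<zero>\<^bsub>M\<^esub>}"

definition graded_prime_submodule ::
  "('a, 'c) ring_scheme \<Rightarrow> ('g \<Rightarrow> 'a set) \<Rightarrow> ('a, 'b) module \<Rightarrow> ('g \<Rightarrow> 'b set) \<Rightarrow> 'b set \<Rightarrow> bool" where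
  "graded_prime_submodule R gR M gM P \<longleftrightarrow> graded_submodule R M gM P \<and> P \<noteq> carrier M \<and>
     (\<forall>r\<in>homog gR. \<forall>m\<in>homog gM. r \<odot>\<^bsub>M\<^esub> m \<in> P \<longrightarrow> m \<in> P \<or> r \<in> colon R M P)"

definition Gr_M ::
  "('a, 'c) ring_scheme \<Rightarrow> ('g \<Rightarrow> 'a set) \<Rightarrow> ('a, 'b) module \<Rightarrow> ('g \<Rightarrow> 'b set) \<Rightarrow> 'b set \<Rightarrow> 'b set" where
  "Gr_M R gR M gM K =
     (if \<exists>P. graded_prime_submodule R gR M gM P \<and> K \<subseteq> P
      then \<Inter>{P. graded_prime_submodule R gR M gM P \<and> K \<subseteq> P}
      else carrier M)"

definition graded_primeful ::
  "('a, 'c) ring_scheme \<Rightarrow> ('g \<Rightarrow> 'a set) \<Rightarrow> ('a, 'b) module \<Rightarrow> ('g \<Rightarrow> 'b set) \<Rightarrow> 'b set \<Rightarrow> bool" where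
  "graded_primeful R gR M gM K \<longleftrightarrow>
     (\<forall>p\<in>Spec_g R gR. colon R M K \<subseteq> p \<longrightarrow>
        (\<exists>P. graded_prime_submodule R gR M gM P \<and> K \<subseteq> P \<and> colon R M P = p))"

definition graded_quasi_primary_submodule ::
  "('a, 'c) ring_scheme \<Rightarrow> ('g \<Rightarrow> 'a set) \<Rightarrow> ('a, 'b) module \<Rightarrow> ('g \<Rightarrow> 'b set) \<Rightarrow> 'b set \<Rightarrow> bool" where
  "graded_quasi_primary_submodule R gR M gM Q \<longleftrightarrow> graded_submodule R M gM Q \<and> Q \<noteq> carrier M \<and>
     (\<forall>r\<in>homog gR. \<forall>m\<in>homog gM. r \<odot>\<^bsub>M\<^esub> m \<in> Q \<longrightarrow>
        r \<in> Gr R gR (colon R M Q) \<or> m \<in> Gr_M R gR M gM Q)"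

definition qp_Spec_g ::
  "('a, 'c) ring_scheme \<Rightarrow> ('g \<Rightarrow> 'a set) \<Rightarrow> ('a, 'b) module \<Rightarrow> ('g \<Rightarrow> 'b set) \<Rightarrow> 'b set set" where
  "qp_Spec_g R gR M gM = {Q. graded_quasi_primary_submodule R gR M gM Q \<and> graded_primeful R gR M gM Q}"

definition qp_V_g ::
  "('a, 'c) ring_scheme \<Rightarrow> ('g \<Rightarrow> 'a set) \<Rightarrow> ('a, 'b) module \<Rightarrow> ('g \<Rightarrow> 'b set) \<Rightarrow> 'b set \<Rightarrow> 'b set set" where
  "qp_V_g R gR M gM K = {Q \<in> qp_Spec_g R gR M gM.
      Gr R gR (colon R M K) \<subseteq> Gr R gR (colon R M Q)}"

definition graded_quasi_primaryful ::
  "('a, 'c) ring_scheme \<Rightarrow> ('g \<Rightarrow> 'a set) \<Rightarrow> ('a, 'b) module \<Rightarrow> ('g \<Rightarrow> 'b set) \<Rightarrow> bool" where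
  "graded_quasi_primaryful R gR M gM \<longleftrightarrow> carrier M = {\<zero>\<^bsub>M\<^esub>} \<or>
     (carrier M \<noteq> {\<zero>\<^bsub>M\<^esub>} \<and>
      (\<forall>q. graded_quasi_primary_ideal R gR q \<and> Ann R M \<subseteq> q \<longrightarrow>
           (\<exists>Q\<in>qp_Spec_g R gR M gM. Gr R gR (colon R M Q) = Gr R gR q)))"

definition Rbar :: "('a, 'c) ring_scheme \<Rightarrow> ('a, 'b) module \<Rightarrow> 'a set ring" where
  "Rbar R M = R Quot (Ann R M)"

definition cls :: "('a, 'c) ring_scheme \<Rightarrow> ('a, 'b) module \<Rightarrow> 'a \<Rightarrow> 'a set" where
  "cls R M a = Ann R M +>\<^bsub>R\<^esub> a"

definition bar :: "('a, 'c) ring_scheme \<Rightarrow> ('a, 'b) module \<Rightarrow> 'a set \<Rightarrow> 'a set set" where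
  "bar R M I = cls R M ` I"

definition gRbar :: "('a, 'c) ring_scheme \<Rightarrow> ('g \<Rightarrow> 'a set) \<Rightarrow> ('a, 'b) module \<Rightarrow> 'g \<Rightarrow> 'a set set" where
  "gRbar R gR M g = bar R M (gR g)"

definition phi ::
  "('a, 'c) ring_scheme \<Rightarrow> ('g \<Rightarrow> 'a set) \<Rightarrow> ('a, 'b) module \<Rightarrow> 'b set \<Rightarrow> 'a set set" where
  "phi R gR M Q = bar R M (Gr R gR (colon R M Q))"

end

theory Submission
  imports Defs
begin

text \<open>
  The largest graded ideal inside an ordinary prime ideal is graded prime, so by Krull's argument
  the graded radical of a graded ideal is the intersection of the graded primes above it.
  For \<open>Q\<close> in \<open>qp.Spec\<^sub>g(M)\<close> the primeful property realises these primes
  as \<open>(P : M)\<close> with \<open>P \<supseteq> Q\<close> graded prime; since \<open>Gr\<^sub>M(Q) \<subseteq> P\<close>,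
  the quasi-primary condition on \<open>Q\<close> forces \<open>Gr(Q : M)\<close> to be a graded prime.
  As graded primes are quasi-primary and equal to their radical, quasi-primaryfulness then makes
  \<open>\<phi>\<close> surjective onto the graded primes of \<open>R/Ann(M)\<close>. Both claims follow because membership
  of \<open>Q\<close> in the closed set of \<open>K\<close> depends only on \<open>\<phi>(Q)\<close>.
\<close>

section \<open>Homogeneous components in a graded abelian group, shared by the ring and the
  module\<close>

locale graded_abelian_group = abelian_group A for A (structure) +
  fixes gr :: "'g \<Rightarrow> 'a set"
  assumes gr_subgroup: "additive_subgroup (gr g) A"
    and decomposition: "x \<in> carrier A \<Longrightarrow>
      \<exists>!c. (\<forall>g. c g \<in> gr g) \<and> finite {g. c g \<noteq> \<zero>} \<and> x = finsum A c {g. c g \<noteq> \<zero>}"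
begin

lemma gr_closed: "x \<in> gr g \<Longrightarrow> x \<in> carrier A"
  using additive_subgroup.a_Hcarr[OF gr_subgroup] .

lemma gr_zero: "\<zero> \<in> gr g"
  using additive_subgroup.zero_closed[OF gr_subgroup] .

lemma homog_closed: "x \<in> homog gr \<Longrightarrow> x \<in> carrier A"
  unfolding homog_def using gr_closed by blast

lemma hcomp_decomposition:
  assumes "x \<in> carrier A"
  shows "\<forall>g. hcomp A gr x g \<in> gr g" "finite {g. hcomp A gr x g \<noteq> \<zero>}"
    "x = finsum A (hcomp A gr x) {g. hcomp A gr x g \<noteq> \<zero>}"
  using theI'[OF decomposition[OF assms]] unfolding hcomp_def by blast+

lemma hcomp_in_gr: "x \<in> carrier A \<Longrightarrow> hcomp A gr x g \<in> gr g"
  using hcomp_decomposition(1) by blast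

lemma hcomp_in_homog: "x \<in> carrier A \<Longrightarrow> hcomp A gr x g \<in> homog gr"
  unfolding homog_def using hcomp_in_gr by blast

lemma hcomp_closed [simp]: "x \<in> carrier A \<Longrightarrow> hcomp A gr x g \<in> carrier A"
  using gr_closed[OF hcomp_in_gr] .

text \<open>Padding \<open>c\<close> by zero outside \<open>S\<close> gives a family that meets the
  defining conditions of \<open>hcomp\<close>, so uniqueness of the decomposition identifies the
  two. The support may be smaller than \<open>S\<close>, as some \<open>c g\<close> may
  vanish.\<close>

lemma hcomp_finsum:
  assumes S: "finite S" and c: "\<And>g. g \<in> S \<Longrightarrow> c g \<in> gr g"
  shows "hcomp A gr (finsum A c S) g = (if g \<in> S then c g else \<zero>)"
proof -
  define d where "d g = (if g \<in> S then c g else \<zero>)" for g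
  have d: "\<forall>g. d g \<in> gr g"
    unfolding d_def using c gr_zero by auto
  have supp: "{g. d g \<noteq> \<zero>} \<subseteq> S"
    unfolding d_def by auto
  have "finsum A c S = finsum A d {g. d g \<noteq> \<zero>}"
    by (rule add.finprod_mono_neutral_cong_right[OF S supp])
       (use c gr_closed in \<open>auto simp: d_def\<close>)
  moreover have "finsum A c S \<in> carrier A"
    using c gr_closed by (intro finsum_closed) auto
  ultimately have "hcomp A gr (finsum A c S) = d"
    unfolding hcomp_def using d supp S
    by (intro the1_equality[OF decomposition]) (auto intro: finite_subset)
  then show ?thesis
    by (simp add: d_def)
qed

lemma hcomp_homogeneous:
  assumes "x \<in> gr h"
  shows "hcomp A gr x g = (if g = h then x else \<zero>)"
  using hcomp_finsum[of "{h}" "\<lambda>_. x" g] assms gr_closed[OF assms] by simp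

lemma finsum_hcomp:
  assumes "x \<in> carrier A" "finite S" "{g. hcomp A gr x g \<noteq> \<zero>} \<subseteq> S"
  shows "finsum A (hcomp A gr x) S = x"
proof -
  have "finsum A (hcomp A gr x) S = finsum A (hcomp A gr x) {g. hcomp A gr x g \<noteq> \<zero>}"
    by (rule add.finprod_mono_neutral_cong_right) (use assms in auto)
  then show ?thesis
    using hcomp_decomposition(3)[OF assms(1)] by simp
qed

lemma hcomp_add:
  assumes "x \<in> carrier A" "y \<in> carrier A"
  shows "hcomp A gr (x \<oplus> y) g = hcomp A gr x g \<oplus> hcomp A gr y g"
proof -
  define S where "S = {g. hcomp A gr x g \<noteq> \<zero>} \<union> {g. hcomp A gr y g \<noteq> \<zero>}"
  have S: "finite S"
    unfolding S_def using hcomp_decomposition(2) assms by auto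
  have "x \<oplus> y = finsum A (\<lambda>g. hcomp A gr x g \<oplus> hcomp A gr y g) S"
    using finsum_addf[of "hcomp A gr x" S "hcomp A gr y"] assms S
      finsum_hcomp[OF assms(1) S] finsum_hcomp[OF assms(2) S]
    by (auto simp: S_def)
  moreover have "hcomp A gr x g \<oplus> hcomp A gr y g \<in> gr g" for g
    using additive_subgroup.a_closed[OF gr_subgroup] hcomp_in_gr assms by blast
  ultimately have "hcomp A gr (x \<oplus> y) g = (if g \<in> S then hcomp A gr x g \<oplus> hcomp A gr y g else \<zero>)"
    using hcomp_finsum[OF S] by simp
  then show ?thesis
    by (auto simp: S_def)
qed

lemma finsum_mem_subgroup:
  assumes "additive_subgroup J A" "\<And>g. g \<in> S \<Longrightarrow> c g \<in> J"
  shows "finsum A c S \<in> J"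
proof -
  interpret J: additive_subgroup J A by fact
  show ?thesis
    using assms(2)
  \<comment> \<open>A sum over an infinite set is \<open>\<zero>\<close> by convention, which lies
    in \<open>J\<close>.\<close>
  proof (induction S rule: infinite_finite_induct)
    case (insert g S)
    then have "finsum A c (insert g S) = c g \<oplus> finsum A c S"
      by (intro finsum_insert) auto
    then show ?case
      using insert by simp
  qed auto
qed

lemma mem_subgroup_if_hcomp_mem:
  assumes "additive_subgroup J A" "x \<in> carrier A" "\<And>g. hcomp A gr x g \<in> J"
  shows "x \<in> J"
proof -
  have "finsum A (hcomp A gr x) {g. hcomp A gr x g \<noteq> \<zero>} \<in> J"
    using assms(1,3) by (rule finsum_mem_subgroup)
  then show ?thesis
    using hcomp_decomposition(3)[OF assms(2)] by simp
qed

text \<open>By uniqueness, a sum of homogeneous elements of \<open>J\<close> with distinct degrees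
  is already the canonical decomposition. This turns the existential definition of gradedness into
  closure under \<open>hcomp\<close>, for ideals and submodules alike.\<close>

lemma homogeneous_sums_iff:
  assumes J: "additive_subgroup J A"
  shows "(\<forall>x\<in>J. \<exists>S c. finite S \<and> (\<forall>g\<in>S. c g \<in> J \<inter> gr g) \<and> x = finsum A c S)
    \<longleftrightarrow> (\<forall>x\<in>J. \<forall>g. hcomp A gr x g \<in> J)" (is "?L \<longleftrightarrow> ?R")
proof
  assume ?L
  then show ?R
    using hcomp_finsum additive_subgroup.zero_closed[OF J]
    by (metis IntE)
next
  assume R: ?R
  have "x \<in> carrier A" if "x \<in> J" for x
    using additive_subgroup.a_Hcarr[OF J that] .
  then show ?L
    using R hcomp_decomposition by (metis IntI)
qed

end

section \<open>Graded commutative rings and the homogeneous core of an ideal\<close>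

locale graded_commutative_ring = cring R + graded_abelian_group R gR
  for R :: "('a, 'c) ring_scheme" (structure) and gR :: "'g::group_add \<Rightarrow> 'a set" +
  assumes gr_mult: "a \<in> gR g \<Longrightarrow> b \<in> gR h \<Longrightarrow> a \<otimes> b \<in> gR (g + h)"
begin

lemma homog_mult: "a \<in> homog gR \<Longrightarrow> b \<in> homog gR \<Longrightarrow> a \<otimes> b \<in> homog gR"
  unfolding homog_def using gr_mult by blast

text \<open>The exponent is positive because the zeroth power is \<open>\<one>\<close>, whose
  homogeneity would need an argument of its own.\<close>

lemma homog_pow:
  assumes "a \<in> homog gR"
  shows "a [^] Suc n \<in> homog gR"
proof (induction n)
  case 0
  then show ?case using assms homog_closed by simp
next
  case (Suc n)
  then show ?case using homog_mult[OF Suc assms] by simp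
qed

lemma graded_ideal_iff:
  "graded_ideal R gR I \<longleftrightarrow> ideal I R \<and> (\<forall>x\<in>I. \<forall>g. hcomp R gR x g \<in> I)"
proof (cases "ideal I R")
  case True
  then show ?thesis
    using homogeneous_sums_iff[OF ideal.axioms(1)[OF True]] unfolding graded_ideal_def by simp
qed (simp add: graded_ideal_def)

lemma graded_prime_ideal_pow:
  assumes p: "graded_prime_ideal R gR p" and a: "a \<in> homog gR" "a [^] (n::nat) \<in> p" "n > 0"
  shows "a \<in> p"
proof -
  have "a [^] Suc k \<in> p \<Longrightarrow> a \<in> p" for k
  proof (induction k)
    case 0
    then show ?case using homog_closed[OF a(1)] by simp
  next
    case (Suc k)
    then have "a [^] Suc k \<otimes> a \<in> p"
      by simp
    then have "a [^] Suc k \<in> p \<or> a \<in> p"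
      using p a(1) homog_pow[OF a(1)] unfolding graded_prime_ideal_def by blast
    then show ?case using Suc.IH by blast
  qed
  then show ?thesis
    using a gr0_conv_Suc by metis
qed

text \<open>For an ideal \<open>J\<close> this is the largest graded ideal contained in
  \<open>J\<close>.\<close>

definition homogeneous_core :: "'a set \<Rightarrow> 'a set" where
  "homogeneous_core J = {x \<in> carrier R. \<forall>g. hcomp R gR x g \<in> J}"

lemma homogeneous_core_subset:
  assumes "ideal J R"
  shows "homogeneous_core J \<subseteq> J"
  using mem_subgroup_if_hcomp_mem[OF ideal.axioms(1)[OF assms]]
  unfolding homogeneous_core_def by blast

lemma homog_in_homogeneous_core:
  assumes "ideal J R" "x \<in> homog gR" "x \<in> J"
  shows "x \<in> homogeneous_core J"
proof -
  obtain h where h: "x \<in> gR h"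
    using assms(2) unfolding homog_def by blast
  show ?thesis
    using assms(3) gr_closed[OF h] additive_subgroup.zero_closed[OF ideal.axioms(1)[OF assms(1)]]
    unfolding homogeneous_core_def by (simp add: hcomp_homogeneous[OF h])
qed

text \<open>The delicate point is closure under multiplication by an arbitrary \<open>r\<close>.
  Splitting both factors into components reduces it to products of homogeneous elements; these are
  homogeneous and lie in \<open>J\<close>, hence in the core.\<close>

lemma homogeneous_core_ideal:
  assumes J: "ideal J R"
  shows "graded_ideal R gR (homogeneous_core J)"
proof -
  interpret J: ideal J R by fact
  let ?C = "homogeneous_core J"
  have carr: "?C \<subseteq> carrier R"
    unfolding homogeneous_core_def by blast
  have zero: "\<zero> \<in> ?C"
    using hcomp_homogeneous[OF gr_zero] unfolding homogeneous_core_def by simp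
  have add: "x \<oplus> y \<in> ?C" if "x \<in> ?C" "y \<in> ?C" for x y
    using that unfolding homogeneous_core_def by (simp add: hcomp_add)
  \<comment> \<open>\<open>finsum_mem_subgroup\<close> cannot be used yet: closure under negation
    will come from \<open>mult\<close>, which itself relies on \<open>sum\<close>.\<close>
  have sum: "finsum R c S \<in> ?C" if "\<And>g. g \<in> S \<Longrightarrow> c g \<in> ?C" for c :: "'g \<Rightarrow> 'a" and S
    using that
  proof (induction S rule: infinite_finite_induct)
    case (insert g S)
    then have "finsum R c (insert g S) = c g \<oplus> finsum R c S"
      using carr by (intro finsum_insert) auto
    then show ?case
      using insert add by simp
  qed (use zero in auto)
  have mult: "r \<otimes> x \<in> ?C" if r: "r \<in> carrier R" and x: "x \<in> ?C" for r x
  proof -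
    have xc: "x \<in> carrier R" and xJ: "hcomp R gR x g \<in> J" for g
      using x unfolding homogeneous_core_def by auto
    let ?S = "{g. hcomp R gR r g \<noteq> \<zero>}" and ?T = "{g. hcomp R gR x g \<noteq> \<zero>}"
    have "r \<otimes> x = finsum R (hcomp R gR r) ?S \<otimes> x"
      using hcomp_decomposition(3)[OF r] by simp
    also have "\<dots> = finsum R (\<lambda>g. hcomp R gR r g \<otimes> x) ?S"
      using hcomp_decomposition(2)[OF r] xc r by (intro finsum_ldistr) auto
    finally have rx: "r \<otimes> x = finsum R (\<lambda>g. hcomp R gR r g \<otimes> x) ?S" .
    have "hcomp R gR r g \<otimes> x \<in> ?C" for g
    proof -
      have "hcomp R gR r g \<otimes> x = hcomp R gR r g \<otimes> finsum R (hcomp R gR x) ?T"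
        using hcomp_decomposition(3)[OF xc] by simp
      also have "\<dots> = finsum R (\<lambda>h. hcomp R gR r g \<otimes> hcomp R gR x h) ?T"
        using hcomp_decomposition(2)[OF xc] xc r by (intro finsum_rdistr) auto
      also have "\<dots> \<in> ?C"
        using homog_mult[OF hcomp_in_homog[OF r] hcomp_in_homog[OF xc]] r xc xJ J.I_l_closed
        by (intro sum homog_in_homogeneous_core[OF J]) auto
      finally show ?thesis .
    qed
    then show ?thesis
      unfolding rx by (rule sum)
  qed
  have "subgroup ?C (add_monoid R)"
  proof (rule subgroup.intro)
    show "inv\<^bsub>add_monoid R\<^esub> x \<in> ?C" if "x \<in> ?C" for x
    proof -
      have "\<ominus> x = (\<ominus> \<one>) \<otimes> x"
        using that carr by (auto simp: l_minus)
      then have "\<ominus> x \<in> ?C"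
        using mult[OF _ that] by simp
      then show ?thesis
        by (simp add: a_inv_def)
    qed
  qed (use carr zero add in auto)
  moreover have "x \<otimes> r \<in> ?C" if "r \<in> carrier R" "x \<in> ?C" for r x
    using mult[OF that] m_comm[of r x] that carr by auto
  ultimately have "ideal ?C R"
    using mult by (intro idealI ring_axioms)
  moreover have "hcomp R gR x g \<in> ?C" if "x \<in> ?C" for x g
    using that hcomp_in_homog by (intro homog_in_homogeneous_core[OF J])
      (auto simp: homogeneous_core_def)
  ultimately show ?thesis
    unfolding graded_ideal_iff by blast
qed

text \<open>Graded primality is tested on homogeneous elements only, and for those membership in the
  core and in \<open>P\<close> agree.\<close>

lemma homogeneous_core_prime:
  assumes P: "primeideal P R"
  shows "graded_prime_ideal R gR (homogeneous_core P)"
proof -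
  interpret P: primeideal P R by fact
  note sub = homogeneous_core_subset[OF P.is_ideal]
  have "homogeneous_core P \<noteq> carrier R"
    using sub P.I_notcarr P.a_subset by blast
  moreover have "a \<in> homogeneous_core P \<or> b \<in> homogeneous_core P"
    if "a \<in> homog gR" "b \<in> homog gR" "a \<otimes> b \<in> homogeneous_core P" for a b
    using P.I_prime[of a b] that sub homog_closed homog_in_homogeneous_core[OF P.is_ideal] by auto
  ultimately show ?thesis
    unfolding graded_prime_ideal_def using homogeneous_core_ideal[OF P.is_ideal] by auto
qed

end

section \<open>Krull's prime avoidance in an ungraded commutative ring\<close>

lemma (in cring) ideal_insert:
  assumes J: "ideal J R" and x: "x \<in> carrier R"
  obtains J' where "ideal J' R" "J \<subseteq> J'" "x \<in> J'"
    "\<And>z. z \<in> J' \<Longrightarrow> \<exists>j\<in>J. \<exists>r\<in>carrier R. z = j \<oplus> r \<otimes> x"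
proof
  interpret J: ideal J R by fact
  let ?J = "J <+>\<^bsub>R\<^esub> PIdl x"
  show "ideal ?J R"
    using add_ideals[OF J cgenideal_ideal[OF x]] .
  show "\<exists>j\<in>J. \<exists>r\<in>carrier R. z = j \<oplus> r \<otimes> x" if "z \<in> ?J" for z
    using that unfolding set_add_def' cgenideal_def by blast
  have mem: "j \<oplus> r \<otimes> x \<in> ?J" if "j \<in> J" "r \<in> carrier R" for j r
    using that unfolding set_add_def' cgenideal_def by blast
  show "J \<subseteq> ?J"
    using mem[of _ \<zero>] x J.a_Hcarr by force
  show "x \<in> ?J"
    using mem[of \<zero> \<one>] x by simp
qed

text \<open>Zorn's lemma yields an ideal maximal among those that contain \<open>I\<close> and miss
  all powers of \<open>a\<close>; such an ideal is prime.\<close>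

lemma (in cring) exists_primeideal_avoiding_powers:
  assumes I: "ideal I R" and a: "a \<in> carrier R" and pow: "\<And>n::nat. a [^] n \<notin> I"
  obtains P where "primeideal P R" "I \<subseteq> P" "a \<notin> P"
proof -
  define F where "F = {J. ideal J R \<and> I \<subseteq> J \<and> (\<forall>n::nat. a [^] n \<notin> J)}"
  have "I \<in> F"
    unfolding F_def using I pow by blast
  moreover have "\<Union>C \<in> F" if "C \<noteq> {}" "subset.chain F C" for C
  proof -
    have CF: "C \<subseteq> F"
      using that(2) unfolding pred_on.chain_def by blast
    have "subset.chain {J. ideal J R} C"
      using that(2) CF unfolding pred_on.chain_def F_def by blast
    then have "ideal (\<Union>C) R"
      using chain_Union_is_ideal[of C] that(1) by simp
    then show ?thesis
      using CF that(1) unfolding F_def by blast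
  qed
  ultimately obtain P where P: "P \<in> F" and max: "\<And>J. J \<in> F \<Longrightarrow> P \<subseteq> J \<Longrightarrow> J = P"
    using subset_Zorn_nonempty[of F] by blast
  then have Pid: "ideal P R" and IP: "I \<subseteq> P" and powP: "\<And>n::nat. a [^] n \<notin> P"
    unfolding F_def by auto
  interpret P: ideal P R by fact
  \<comment> \<open>By maximality, the ideal generated by \<open>P\<close> and \<open>x\<close>
    contains a power of \<open>a\<close>.\<close>
  have meets: "\<exists>j\<in>P. \<exists>r\<in>carrier R. \<exists>n::nat. a [^] n = j \<oplus> r \<otimes> x"
    if x: "x \<in> carrier R" "x \<notin> P" for x
  proof -
    obtain J where J: "ideal J R" "P \<subseteq> J" "x \<in> J"
      "\<And>z. z \<in> J \<Longrightarrow> \<exists>j\<in>P. \<exists>r\<in>carrier R. z = j \<oplus> r \<otimes> x"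
      using ideal_insert[OF Pid x(1)] by blast
    have "J \<notin> F"
      using max J x(2) by blast
    then obtain n :: nat where "a [^] n \<in> J"
      using J IP unfolding F_def by blast
    then show ?thesis
      using J(4) by metis
  qed
  have "primeideal P R"
  proof (rule primeidealI[OF Pid is_cring])
    \<comment> \<open>The exponent 0 is among those avoided, so \<open>\<one>\<close> is not in
      \<open>P\<close>.\<close>
    show "carrier R \<noteq> P"
      using powP[of 0] by auto
    fix x y assume xy: "x \<in> carrier R" "y \<in> carrier R" "x \<otimes> y \<in> P"
    show "x \<in> P \<or> y \<in> P"
    proof (rule ccontr)
      assume "\<not> (x \<in> P \<or> y \<in> P)"
      then obtain i r j s and m n :: nat where
        i: "i \<in> P" "r \<in> carrier R" "a [^] m = i \<oplus> r \<otimes> x" and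
        j: "j \<in> P" "s \<in> carrier R" "a [^] n = j \<oplus> s \<otimes> y"
        using meets xy by metis
      note c = i(2) j(2) xy(1,2) P.a_Hcarr[OF i(1)] P.a_Hcarr[OF j(1)]
      have "a [^] (m + n) = (i \<oplus> r \<otimes> x) \<otimes> (j \<oplus> s \<otimes> y)"
        using i(3) j(3) a nat_pow_mult by metis
      \<comment> \<open>The grouping puts a factor from \<open>P\<close> into each summand:
        \<open>i\<close>, then \<open>j\<close>, then \<open>x \<otimes> y\<close>.\<close>
      also have "\<dots> = (i \<otimes> (j \<oplus> s \<otimes> y) \<oplus> (r \<otimes> x) \<otimes> j) \<oplus> (r \<otimes> s) \<otimes> (x \<otimes> y)"
        using c by algebra
      also have "\<dots> \<in> P"
        using c i j xy(3) by (simp add: P.I_l_closed P.I_r_closed)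
      finally show False
        using powP by blast
    qed
  qed
  moreover have "a \<notin> P"
    using powP[of 1] a by simp
  ultimately show thesis
    using that IP by blast
qed

section \<open>The graded radical as an intersection of graded primes\<close>

context graded_commutative_ring
begin

text \<open>The homogeneous core of Krull's prime works: being graded, \<open>I\<close> stays inside
  the core, and the core still misses \<open>a\<close>.\<close>

lemma exists_graded_prime_avoiding:
  assumes I: "graded_ideal R gR I" and a: "a \<in> carrier R" and pow: "\<And>n::nat. n > 0 \<Longrightarrow> a [^] n \<notin> I"
  obtains p where "graded_prime_ideal R gR p" "I \<subseteq> p" "a \<notin> p"
proof -
  have I_ideal: "ideal I R" and I_comp: "\<And>x g. x \<in> I \<Longrightarrow> hcomp R gR x g \<in> I"
    using I unfolding graded_ideal_iff by auto
  interpret I: ideal I R by fact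
  \<comment> \<open>This supplies exponent 0: if \<open>\<one>\<close> were in \<open>I\<close>,
    then so would be \<open>a\<close> itself.\<close>
  have "\<one> \<notin> I"
    using pow[of 1] a I.one_imp_carrier by auto
  then have "a [^] n \<notin> I" for n :: nat
    using pow[of n] by (cases "n = 0") auto
  then obtain P where P: "primeideal P R" "I \<subseteq> P" "a \<notin> P"
    using exists_primeideal_avoiding_powers[OF I_ideal a] by blast
  have "I \<subseteq> homogeneous_core P"
    using I_comp P(2) I.a_subset unfolding homogeneous_core_def by blast
  then show thesis
    using that homogeneous_core_prime[OF P(1)] P(3)
      homogeneous_core_subset[OF primeideal.axioms(1)[OF P(1)]] by blast
qed

text \<open>\<open>Gr\<close> is defined componentwise, and graded ideals contain an element exactly
  when they contain its components. So the claim reduces to a single component, where powers pull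
  back into graded primes and, conversely, a component with no positive power in \<open>I\<close> is
  avoided by some graded prime above \<open>I\<close>.\<close>

lemma Gr_eq_Inter_primes:
  assumes I: "graded_ideal R gR I"
  shows "Gr R gR I = {x \<in> carrier R. \<forall>p. graded_prime_ideal R gR p \<longrightarrow> I \<subseteq> p \<longrightarrow> x \<in> p}"
proof (intro subset_antisym subsetI CollectI conjI allI impI)
  fix x assume x: "x \<in> Gr R gR I"
  then show xc: "x \<in> carrier R"
    unfolding Gr_def by blast
  fix p assume p: "graded_prime_ideal R gR p" "I \<subseteq> p"
  have "hcomp R gR x g \<in> p" for g
  proof -
    obtain n :: nat where "n > 0" "hcomp R gR x g [^] n \<in> I"
      using x unfolding Gr_def by blast
    then show ?thesis
      using graded_prime_ideal_pow[OF p(1) hcomp_in_homog[OF xc]] p(2) by blast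
  qed
  then show "x \<in> p"
    using mem_subgroup_if_hcomp_mem[OF ideal.axioms(1) xc] p(1)
    unfolding graded_prime_ideal_def graded_ideal_def by blast
next
  fix x assume x: "x \<in> {x \<in> carrier R. \<forall>p. graded_prime_ideal R gR p \<longrightarrow> I \<subseteq> p \<longrightarrow> x \<in> p}"
  then have xc: "x \<in> carrier R"
    by blast
  have "\<exists>n::nat. n > 0 \<and> hcomp R gR x g [^] n \<in> I" for g
  proof (rule ccontr)
    assume "\<not> ?thesis"
    then obtain p where p: "graded_prime_ideal R gR p" "I \<subseteq> p" "hcomp R gR x g \<notin> p"
      using exists_graded_prime_avoiding[OF I hcomp_closed[OF xc]] by blast
    then show False
      using x unfolding graded_prime_ideal_def graded_ideal_iff by blast
  qed
  then show "x \<in> Gr R gR I"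
    unfolding Gr_def using xc by blast
qed

lemma Gr_superset:
  assumes I: "graded_ideal R gR I"
  shows "I \<subseteq> Gr R gR I"
proof -
  interpret ideal I R
    using I unfolding graded_ideal_iff by blast
  show ?thesis
    using a_subset unfolding Gr_eq_Inter_primes[OF I] by blast
qed

lemma Gr_prime:
  assumes p: "graded_prime_ideal R gR p"
  shows "Gr R gR p = p"
proof -
  have gp: "graded_ideal R gR p"
    using p unfolding graded_prime_ideal_def by blast
  show ?thesis
    using Gr_superset[OF gp] Gr_eq_Inter_primes[OF gp] p by auto
qed

lemma graded_ideal_carrier: "graded_ideal R gR (carrier R)"
  unfolding graded_ideal_iff using oneideal by simp

lemma graded_ideal_Inter:
  assumes "F \<noteq> {}" "\<And>I. I \<in> F \<Longrightarrow> graded_ideal R gR I"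
  shows "graded_ideal R gR (\<Inter>F)"
proof -
  have "ideal (\<Inter>F) R"
    using assms by (intro i_Intersect) (auto simp: graded_ideal_iff)
  then show ?thesis
    using assms(2) by (auto simp: graded_ideal_iff)
qed

lemma Gr_graded_ideal:
  assumes I: "graded_ideal R gR I"
  shows "graded_ideal R gR (Gr R gR I)"
proof -
  \<comment> \<open>Inserting the carrier keeps the family nonempty even if no graded prime contains
    \<open>I\<close>.\<close>
  have "Gr R gR I = \<Inter>(insert (carrier R) {p. graded_prime_ideal R gR p \<and> I \<subseteq> p})"
    unfolding Gr_eq_Inter_primes[OF I] by blast
  also have "graded_ideal R gR \<dots>"
    using graded_ideal_carrier by (intro graded_ideal_Inter) (auto simp: graded_prime_ideal_def)
  finally show ?thesis .
qed

lemma Gr_proper: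
  assumes I: "graded_ideal R gR I" and proper: "I \<noteq> carrier R"
  shows "Gr R gR I \<noteq> carrier R"
proof -
  interpret I: ideal I R
    using I unfolding graded_ideal_iff by blast
  have "\<one> \<notin> I"
    using I.one_imp_carrier proper by blast
  then obtain p where "graded_prime_ideal R gR p" "I \<subseteq> p" "\<one> \<notin> p"
    using exists_graded_prime_avoiding[OF I one_closed] by auto
  then show ?thesis
    unfolding Gr_eq_Inter_primes[OF I] by blast
qed

lemma Gr_homogeneous_pow:
  assumes "x \<in> Gr R gR I" "x \<in> homog gR"
  obtains n :: nat where "n > 0" "x [^] n \<in> I"
proof -
  obtain h where "x \<in> gR h"
    using assms(2) unfolding homog_def by blast
  then have "hcomp R gR x h = x"
    by (simp add: hcomp_homogeneous)
  moreover obtain n :: nat where "n > 0" "hcomp R gR x h [^] n \<in> I"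
    using assms(1) unfolding Gr_def by blast
  ultimately show thesis
    using that by simp
qed

lemma graded_prime_imp_quasi_primary:
  assumes "graded_prime_ideal R gR p"
  shows "graded_quasi_primary_ideal R gR p"
  using assms Gr_prime[OF assms] unfolding graded_prime_ideal_def graded_quasi_primary_ideal_def
  by simp

section \<open>Graded primes of a quotient ring\<close>

lemma coset_mem_image_iff:
  assumes A: "ideal A R" and J: "ideal J R" "A \<subseteq> J" and x: "x \<in> carrier R"
  shows "A +> x \<in> (+>) A ` J \<longleftrightarrow> x \<in> J"
proof
  assume "A +> x \<in> (+>) A ` J"
  then obtain j where j: "A +> x = A +> j" "j \<in> J"
    by (rule imageE)
  interpret A: ideal A R by fact
  interpret J: ideal J R by fact
  have "x \<in> A +> j"
    using A.a_rcos_self[OF x] j(1) by simp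
  then obtain a where "a \<in> A" "x = a \<oplus> j"
    unfolding a_r_coset_def' by auto
  then show "x \<in> J"
    using j(2) J(2) by auto
qed (rule imageI)

text \<open>The correspondence between primes above \<open>A\<close> and primes of the quotient,
  with the image grading. On the quotient side gradedness is handled through sums of homogeneous
  elements, so uniqueness of decompositions there never enters.\<close>

lemma Spec_g_quotient:
  assumes A: "graded_ideal R gR A"
  shows "Spec_g (R Quot A) (\<lambda>g. (+>) A ` gR g) = (\<lambda>p. (+>) A ` p) ` {p \<in> Spec_g R gR. A \<subseteq> p}"
    (is "Spec_g ?Q ?gQ = ?\<pi> ` _")
proof -
  have A_ideal: "ideal A R"
    using A unfolding graded_ideal_iff by blast
  interpret A: ideal A R by fact
  interpret h: ring_hom_cring R ?Q "(+>) A"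
    using A.rcos_ring_hom_cring[OF is_cring] .
  have homogQ: "homog ?gQ = (+>) A ` homog gR"
    unfolding homog_def by blast
  have carrQ: "carrier ?Q = (+>) A ` carrier R"
    unfolding FactRing_def A_RCOSETS_def' by auto
  have image: "?\<pi> p \<in> Spec_g ?Q ?gQ" if p: "p \<in> Spec_g R gR" "A \<subseteq> p" for p
  proof -
    have gp: "graded_ideal R gR p" "p \<noteq> carrier R"
      and prime: "\<And>a b. a \<in> homog gR \<Longrightarrow> b \<in> homog gR \<Longrightarrow> a \<otimes> b \<in> p \<Longrightarrow> a \<in> p \<or> b \<in> p"
      using p(1) unfolding Spec_g_def graded_prime_ideal_def by auto
    have ip: "ideal p R"
      using gp(1) unfolding graded_ideal_iff by blast
    interpret p: ideal p R by fact
    note mem = coset_mem_image_iff[OF A_ideal ip p(2)]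
    have "\<exists>S c. finite S \<and> (\<forall>g\<in>S. c g \<in> ?\<pi> p \<inter> ?gQ g) \<and> U = finsum ?Q c S" if "U \<in> ?\<pi> p" for U
    proof -
      obtain x where x: "x \<in> p" "U = A +> x"
        using \<open>U \<in> ?\<pi> p\<close> by blast
      obtain S c where c: "finite S" "\<forall>g\<in>S. c g \<in> p \<inter> gR g" "x = finsum R c S"
        using gp(1) x(1) unfolding graded_ideal_def by blast
      have "U = finsum ?Q ((+>) A \<circ> c) S"
        unfolding x(2) c(3) using c(2) gr_closed by (subst h.hom_finsum) auto
      then show ?thesis
        using c(1,2) by (intro exI[of _ S] exI[of _ "(+>) A \<circ> c"]) auto
    qed
    moreover have "ideal (?\<pi> p) ?Q"
      using ring_ideal_imp_quot_ideal[OF A_ideal ip] .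
    moreover have "?\<pi> p \<noteq> carrier ?Q"
    proof -
      obtain x where "x \<in> carrier R" "x \<notin> p"
        using gp(2) p.a_subset by auto
      then show ?thesis
        using mem[of x] carrQ by auto
    qed
    moreover have "U \<in> ?\<pi> p \<or> V \<in> ?\<pi> p"
      if UV: "U \<in> homog ?gQ" "V \<in> homog ?gQ" "U \<otimes>\<^bsub>?Q\<^esub> V \<in> ?\<pi> p" for U V
    proof -
      obtain x y where xy: "x \<in> homog gR" "y \<in> homog gR" "U = A +> x" "V = A +> y"
        using UV(1,2) unfolding homogQ by blast
      then have "A +> (x \<otimes> y) \<in> ?\<pi> p"
        using UV(3) homog_closed by simp
      then have "x \<otimes> y \<in> p"
        using mem xy homog_closed by blast
      then show ?thesis
        using prime xy by blast
    qed
    ultimately show ?thesis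
      unfolding Spec_g_def graded_prime_ideal_def graded_ideal_def
      by (intro CollectI conjI ballI impI)
  qed
  have contraction: "\<exists>p\<in>Spec_g R gR. A \<subseteq> p \<and> P = ?\<pi> p" if P: "P \<in> Spec_g ?Q ?gQ" for P
  proof -
    have iP: "ideal P ?Q" and properP: "P \<noteq> carrier ?Q"
      and sums: "\<And>U. U \<in> P \<Longrightarrow>
        \<exists>S c. finite S \<and> (\<forall>g\<in>S. c g \<in> P \<inter> ?gQ g) \<and> U = finsum ?Q c S"
      and primeP: "\<And>U V. U \<in> homog ?gQ \<Longrightarrow> V \<in> homog ?gQ \<Longrightarrow> U \<otimes>\<^bsub>?Q\<^esub> V \<in> P \<Longrightarrow> U \<in> P \<or> V \<in> P"
      using P unfolding Spec_g_def graded_prime_ideal_def graded_ideal_def by auto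
    interpret P: ideal P ?Q by fact
    define p where "p = {r \<in> carrier R. A +> r \<in> P}"
    have ip: "ideal p R"
      unfolding p_def using ring_hom_ring.ideal_vimage[OF A.rcos_ring_hom_ring iP] .
    interpret p: ideal p R by fact
    have "A \<in> P"
      using P.zero_closed unfolding FactRing_def by simp
    then have Ap: "A \<subseteq> p"
      unfolding p_def using A.a_rcos_const A.a_subset by auto
    have \<pi>p: "?\<pi> p = P"
    proof
      show "?\<pi> p \<subseteq> P"
        unfolding p_def by auto
      show "P \<subseteq> ?\<pi> p"
        using P.a_subset unfolding p_def carrQ by auto
    qed
    note core = homogeneous_core_ideal[OF ip]
    interpret core: ideal "homogeneous_core p" R
      using core unfolding graded_ideal_iff by blast
    \<comment> \<open>The contraction is shown to be graded by proving that it equals its core. The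
      homogeneous summands of the coset of \<open>x\<close> are lifted to elements
      \<open>d g\<close> of \<open>p\<close>; their sum differs from \<open>x\<close> by an element
      of \<open>A\<close>, whose components stay in \<open>A\<close> and thus in
      \<open>p\<close>.\<close>
    have "x \<in> homogeneous_core p" if x: "x \<in> p" for x
    proof -
      have xc: "x \<in> carrier R"
        using x p.a_Hcarr by blast
      obtain S C where C: "finite S" "\<forall>g\<in>S. C g \<in> P \<inter> ?gQ g" "A +> x = finsum ?Q C S"
        using sums[of "A +> x"] x unfolding p_def by blast
      then have "\<forall>g\<in>S. \<exists>d. d \<in> gR g \<and> C g = A +> d"
        by blast
      then obtain d where d: "\<And>g. g \<in> S \<Longrightarrow> d g \<in> gR g \<and> C g = A +> d g"
        by metis
      let ?y = "finsum R d S"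
      have dc: "d \<in> S \<rightarrow> carrier R"
        using d gr_closed by blast
      have "d g \<in> homogeneous_core p" if "g \<in> S" for g
      proof (rule homog_in_homogeneous_core[OF ip])
        have dg: "d g \<in> gR g" "A +> d g \<in> P"
          using d[OF that] C(2) that by auto
        then show "d g \<in> homog gR"
          unfolding homog_def by blast
        show "d g \<in> p"
          unfolding p_def using dg gr_closed by blast
      qed
      then have ymem: "?y \<in> homogeneous_core p"
        using finsum_mem_subgroup[OF core.additive_subgroup_axioms] by blast
      have "A +> ?y = finsum ?Q (\<lambda>g. A +> d g) S"
        using h.hom_finsum[OF dc] by simp
      also have "\<dots> = finsum ?Q C S"
        using d C(2) P.a_subset by (intro h.S.finsum_cong') auto
      finally have "A +> x = A +> ?y"
        using C(3) by simp
      then have "x \<in> A +> ?y"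
        using A.a_rcos_self[OF xc] by simp
      then obtain a where a: "a \<in> A" "x = a \<oplus> ?y"
        unfolding a_r_coset_def' by blast
      have "a \<in> homogeneous_core p"
        using A a(1) Ap A.a_Hcarr unfolding graded_ideal_iff homogeneous_core_def by blast
      then show ?thesis
        using a(2) ymem by simp
    qed
    then have "homogeneous_core p = p"
      using homogeneous_core_subset[OF ip] by blast
    then have gp: "graded_ideal R gR p"
      using core by simp
    have "p \<noteq> carrier R"
      using \<pi>p properP carrQ by blast
    moreover have "a \<in> p \<or> b \<in> p" if "a \<in> homog gR" "b \<in> homog gR" "a \<otimes> b \<in> p" for a b
    proof -
      have "(A +> a) \<otimes>\<^bsub>?Q\<^esub> (A +> b) \<in> P"
        using that homog_closed unfolding p_def by simp
      then show ?thesis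
        using primeP[of "A +> a" "A +> b"] that homog_closed unfolding homogQ p_def by blast
    qed
    ultimately have "graded_prime_ideal R gR p"
      unfolding graded_prime_ideal_def using gp by blast
    then show ?thesis
      unfolding Spec_g_def using Ap \<pi>p[symmetric] by (intro bexI[of _ p] conjI CollectI)
  qed
  show ?thesis
  proof (intro subset_antisym subsetI)
    fix P assume "P \<in> Spec_g ?Q ?gQ"
    then obtain p where "p \<in> {p \<in> Spec_g R gR. A \<subseteq> p}" "P = ?\<pi> p"
      using contraction by auto
    then show "P \<in> ?\<pi> ` {p \<in> Spec_g R gR. A \<subseteq> p}"
      by (rule rev_image_eqI)
  next
    fix P assume "P \<in> ?\<pi> ` {p \<in> Spec_g R gR. A \<subseteq> p}"
    then show "P \<in> Spec_g ?Q ?gQ"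
      using image by auto
  qed
qed

end

section \<open>Graded modules and their colon ideals\<close>

locale graded_module_over_ring = graded_commutative_ring R gR + module R M +
    M: graded_abelian_group M gM
  for R :: "('a, 'c) ring_scheme" (structure) and gR :: "'g::group_add \<Rightarrow> 'a set"
    and M :: "('a, 'b) module" (structure) and gM :: "'g \<Rightarrow> 'b set" +
  assumes gr_smult: "a \<in> gR g \<Longrightarrow> m \<in> gM h \<Longrightarrow> a \<odot>\<^bsub>M\<^esub> m \<in> gM (g + h)"
begin

lemma submodule_additive: "submodule N R M \<Longrightarrow> additive_subgroup N M"
  by (simp add: submodule_def additive_subgroup.intro)

lemma finsum_smult_rdistr:
  assumes "finite S" "f \<in> S \<rightarrow> carrier R" "m \<in> carrier M"
  shows "finsum R f S \<odot>\<^bsub>M\<^esub> m = finsum M (\<lambda>i. f i \<odot>\<^bsub>M\<^esub> m) S"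
  using assms
proof (induction S)
  case (insert i S)
  then show ?case
    by (simp add: smult_l_distr Pi_def)
qed simp

text \<open>Multiplication by \<open>m\<close> of degree \<open>h\<close> shifts degrees by
  \<open>h\<close> on the right. Right translation is injective in the grading group, so distinct
  components of \<open>r\<close> are not merged.\<close>

lemma hcomp_smult:
  assumes r: "r \<in> carrier R" and m: "m \<in> gM h"
  shows "hcomp M gM (r \<odot>\<^bsub>M\<^esub> m) (g + h) = hcomp R gR r g \<odot>\<^bsub>M\<^esub> m"
proof -
  let ?S = "{g. hcomp R gR r g \<noteq> \<zero>}" and ?c = "\<lambda>k. hcomp R gR r (k - h) \<odot>\<^bsub>M\<^esub> m"
  have mc: "m \<in> carrier M"
    using M.gr_closed[OF m] .
  have S: "finite ?S"
    using hcomp_decomposition(2)[OF r] .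
  have inj: "inj_on (\<lambda>g. g + h) ?S"
    by (simp add: inj_on_def)
  have "r \<odot>\<^bsub>M\<^esub> m = finsum R (hcomp R gR r) ?S \<odot>\<^bsub>M\<^esub> m"
    using hcomp_decomposition(3)[OF r] by simp
  also have "\<dots> = finsum M (\<lambda>g. hcomp R gR r g \<odot>\<^bsub>M\<^esub> m) ?S"
    using S r mc by (intro finsum_smult_rdistr) auto
  also have "\<dots> = finsum M ?c ((\<lambda>g. g + h) ` ?S)"
    using r mc by (subst M.finsum_reindex[OF _ inj]) auto
  finally have rm: "r \<odot>\<^bsub>M\<^esub> m = finsum M ?c ((\<lambda>g. g + h) ` ?S)" .
  have "?c k \<in> gM k" for k
    using gr_smult[OF hcomp_in_gr[OF r] m, of "k - h"] by simp
  then have "hcomp M gM (r \<odot>\<^bsub>M\<^esub> m) (g + h) =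
      (if g + h \<in> (\<lambda>g. g + h) ` ?S then ?c (g + h) else \<zero>\<^bsub>M\<^esub>)"
    unfolding rm using S by (intro M.hcomp_finsum) auto
  then show ?thesis
    using mc by (auto simp: image_iff)
qed

lemma colonI_homogeneous:
  assumes N: "submodule N R M" and r: "r \<in> carrier R"
    and "\<And>m. m \<in> homog gM \<Longrightarrow> r \<odot>\<^bsub>M\<^esub> m \<in> N"
  shows "r \<in> colon R M N"
proof -
  have "r \<odot>\<^bsub>M\<^esub> m \<in> N" if m: "m \<in> carrier M" for m
  proof -
    have "r \<odot>\<^bsub>M\<^esub> m = r \<odot>\<^bsub>M\<^esub> finsum M (hcomp M gM m) {g. hcomp M gM m g \<noteq> \<zero>\<^bsub>M\<^esub>}"
      using M.hcomp_decomposition(3)[OF m] by simp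
    also have "\<dots> = finsum M (\<lambda>g. r \<odot>\<^bsub>M\<^esub> hcomp M gM m g) {g. hcomp M gM m g \<noteq> \<zero>\<^bsub>M\<^esub>}"
      using M.hcomp_decomposition(2)[OF m] m r by (intro finsum_smult_ldistr) auto
    also have "\<dots> \<in> N"
      by (intro M.finsum_mem_subgroup[OF submodule_additive[OF N]] assms(3) M.hcomp_in_homog[OF m])
    finally show ?thesis .
  qed
  then show ?thesis
    unfolding colon_def using r by blast
qed

lemma colon_ideal:
  assumes N: "submodule N R M"
  shows "ideal (colon R M N) R"
proof -
  interpret N: additive_subgroup N M
    using submodule_additive[OF N] .
  have scal: "a \<odot>\<^bsub>M\<^esub> n \<in> N" if "a \<in> carrier R" "n \<in> N" for a n
    using submodule.smult_closed[OF N that] .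
  show ?thesis
  proof (intro idealI ring_axioms subgroup.intro)
    show "inv\<^bsub>add_monoid R\<^esub> x \<in> colon R M N" if "x \<in> colon R M N" for x
      using that N.a_inv_closed unfolding colon_def
      by (simp add: smult_l_minus flip: a_inv_def)
  qed (auto simp: colon_def smult_l_distr smult_assoc1 scal)
qed

lemma colon_graded_ideal:
  assumes N: "graded_submodule R M gM N"
  shows "graded_ideal R gR (colon R M N)"
proof -
  have sub: "submodule N R M" and "\<forall>x\<in>N. \<forall>g. hcomp M gM x g \<in> N"
    using N M.homogeneous_sums_iff[OF submodule_additive]
    unfolding graded_submodule_def by auto
  then have comp: "\<And>x g. x \<in> N \<Longrightarrow> hcomp M gM x g \<in> N"
    by blast
  have "hcomp R gR r g \<in> colon R M N" if r: "r \<in> colon R M N" for r g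
  proof (rule colonI_homogeneous[OF sub])
    have rc: "r \<in> carrier R"
      using r unfolding colon_def by blast
    then show "hcomp R gR r g \<in> carrier R"
      by simp
    fix m assume "m \<in> homog gM"
    then obtain h where h: "m \<in> gM h"
      unfolding homog_def by blast
    have "r \<odot>\<^bsub>M\<^esub> m \<in> N"
      using r M.gr_closed[OF h] unfolding colon_def by blast
    then show "hcomp R gR r g \<odot>\<^bsub>M\<^esub> m \<in> N"
      using comp hcomp_smult[OF rc h] by metis
  qed
  then show ?thesis
    unfolding graded_ideal_iff using colon_ideal[OF sub] by blast
qed

lemma graded_submodule_zero: "graded_submodule R M gM {\<zero>\<^bsub>M\<^esub>}"
proof -
  have "submodule {\<zero>\<^bsub>M\<^esub>} R M"
    by (intro submoduleI) auto
  then show ?thesis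
    unfolding graded_submodule_def by (intro conjI ballI exI[of _ "{}"]) auto
qed

lemma Ann_graded_ideal: "graded_ideal R gR (Ann R M)"
  using colon_graded_ideal[OF graded_submodule_zero] unfolding colon_def Ann_def by simp

lemma Ann_subset_colon:
  assumes "submodule N R M"
  shows "Ann R M \<subseteq> colon R M N"
  using additive_subgroup.zero_closed[OF submodule_additive[OF assms]]
  unfolding Ann_def colon_def by auto

text \<open>This makes \<open>phi\<close> land in the graded spectrum. If \<open>a\<close> and
  \<open>b\<close> were both outside the radical, the primeful property would realise a graded prime
  \<open>p\<close> missing \<open>b\<close> as a colon ideal of some \<open>P\<close> above
  \<open>Q\<close>. The quasi-primary condition then pushes a power of \<open>b\<close> into
  \<open>p\<close>.\<close>

lemma Gr_colon_prime:
  assumes Q: "Q \<in> qp_Spec_g R gR M gM"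
  shows "graded_prime_ideal R gR (Gr R gR (colon R M Q))"
proof -
  let ?I = "colon R M Q"
  have gQ: "graded_submodule R M gM Q" and proper: "Q \<noteq> carrier M"
    and qp: "\<And>r m. r \<in> homog gR \<Longrightarrow> m \<in> homog gM \<Longrightarrow> r \<odot>\<^bsub>M\<^esub> m \<in> Q \<Longrightarrow>
      r \<in> Gr R gR ?I \<or> m \<in> Gr_M R gR M gM Q"
    and primeful: "graded_primeful R gR M gM Q"
    using Q unfolding qp_Spec_g_def graded_quasi_primary_submodule_def by auto
  have sub: "submodule Q R M"
    using gQ unfolding graded_submodule_def by blast
  note gI = colon_graded_ideal[OF gQ]
  have "\<one> \<notin> ?I"
    using proper additive_subgroup.a_subset[OF submodule_additive[OF sub]]
    unfolding colon_def by auto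
  then have "Gr R gR ?I \<noteq> carrier R"
    using Gr_proper[OF gI] by blast
  moreover have "a \<in> Gr R gR ?I \<or> b \<in> Gr R gR ?I"
    if a: "a \<in> homog gR" and b: "b \<in> homog gR" and ab: "a \<otimes> b \<in> Gr R gR ?I" for a b
  proof (rule ccontr)
    assume "\<not> ?thesis"
    then have na: "a \<notin> Gr R gR ?I" and nb: "b \<notin> Gr R gR ?I"
      by auto
    have ac: "a \<in> carrier R" and bc: "b \<in> carrier R"
      using a b homog_closed by auto
    obtain n :: nat where n: "n > 0" "(a \<otimes> b) [^] n \<in> ?I"
      using Gr_homogeneous_pow[OF ab homog_mult[OF a b]] .
    have an: "a [^] n \<in> homog gR" and bn: "b [^] n \<in> homog gR"
      using homog_pow[OF a] homog_pow[OF b] n(1) gr0_conv_Suc by metis+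
    \<comment> \<open>A graded prime containing the power would contain \<open>a\<close>, so
      \<open>a\<close> would already be in the radical.\<close>
    have na': "a [^] n \<notin> Gr R gR ?I"
      using na ac n(1) graded_prime_ideal_pow[OF _ a] unfolding Gr_eq_Inter_primes[OF gI] by blast
    obtain p where p: "graded_prime_ideal R gR p" "?I \<subseteq> p" "b \<notin> p"
      using nb bc unfolding Gr_eq_Inter_primes[OF gI] by blast
    obtain P where P: "graded_prime_submodule R gR M gM P" "Q \<subseteq> P" "colon R M P = p"
      using primeful p unfolding graded_primeful_def Spec_g_def by blast
    have "b [^] n \<odot>\<^bsub>M\<^esub> m \<in> P" if m: "m \<in> homog gM" for m
    proof -
      have mc: "m \<in> carrier M"
        using M.homog_closed[OF m] .
      have "(a \<otimes> b) [^] n \<odot>\<^bsub>M\<^esub> m \<in> Q"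
        using n(2) mc unfolding colon_def by blast
      then have "a [^] n \<odot>\<^bsub>M\<^esub> (b [^] n \<odot>\<^bsub>M\<^esub> m) \<in> Q"
        using ac bc mc by (simp add: nat_pow_distrib smult_assoc1)
      moreover have "b [^] n \<odot>\<^bsub>M\<^esub> m \<in> homog gM"
        using bn m gr_smult unfolding homog_def by blast
      ultimately have "b [^] n \<odot>\<^bsub>M\<^esub> m \<in> Gr_M R gR M gM Q"
        using qp[OF an] na' by blast
      \<comment> \<open>The existence of \<open>P\<close> selects the intersection branch of
        \<open>Gr_M\<close>, and \<open>P\<close> is one of the sets intersected.\<close>
      then show ?thesis
        using P(1,2) unfolding Gr_M_def by (auto split: if_splits)
    qed
    then have "b [^] n \<in> p"
      using colonI_homogeneous[of P "b [^] n"] bc P(1,3)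
      unfolding graded_prime_submodule_def graded_submodule_def by auto
    then show False
      using graded_prime_ideal_pow[OF p(1) b] n(1) p(3) by blast
  qed
  ultimately show ?thesis
    unfolding graded_prime_ideal_def using Gr_graded_ideal[OF gI] by blast
qed

section \<open>The natural map to the graded spectrum of the quotient by the annihilator\<close>

lemma Ann_subset_Gr_colon:
  assumes "graded_submodule R M gM N"
  shows "Ann R M \<subseteq> Gr R gR (colon R M N)"
  using Ann_subset_colon Gr_superset[OF colon_graded_ideal[OF assms]] assms
  unfolding graded_submodule_def by blast

text \<open>Since \<open>J\<close> contains the annihilator, it is a union of cosets, so membership
  in \<open>J\<close> can be read off from the coset.\<close>

lemma bar_subset_iff:
  assumes "I \<subseteq> carrier R" "ideal J R" "Ann R M \<subseteq> J"
  shows "bar R M I \<subseteq> bar R M J \<longleftrightarrow> I \<subseteq> J"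
proof -
  have "ideal (Ann R M) R"
    using Ann_graded_ideal unfolding graded_ideal_iff by blast
  then have "cls R M x \<in> bar R M J \<longleftrightarrow> x \<in> J" if "x \<in> I" for x
    using coset_mem_image_iff[of "Ann R M" J x] assms that unfolding bar_def cls_def by blast
  then show ?thesis
    unfolding bar_def by blast
qed

lemma Spec_g_Rbar:
  "Spec_g (Rbar R M) (gRbar R gR M) = bar R M ` {p \<in> Spec_g R gR. Ann R M \<subseteq> p}"
  using Spec_g_quotient[OF Ann_graded_ideal]
  unfolding Rbar_def gRbar_def[abs_def] bar_def[abs_def] cls_def[abs_def] .

lemma phi_image_qp_Spec_g:
  assumes "graded_quasi_primaryful R gR M gM"
  shows "phi R gR M ` qp_Spec_g R gR M gM = Spec_g (Rbar R M) (gRbar R gR M)"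
proof -
  have "phi R gR M Q \<in> Spec_g (Rbar R M) (gRbar R gR M)" if "Q \<in> qp_Spec_g R gR M gM" for Q
  proof -
    have "graded_submodule R M gM Q"
      using that unfolding qp_Spec_g_def graded_quasi_primary_submodule_def by blast
    then have "Gr R gR (colon R M Q) \<in> {p \<in> Spec_g R gR. Ann R M \<subseteq> p}"
      using Gr_colon_prime[OF that] Ann_subset_Gr_colon unfolding Spec_g_def by simp
    then show ?thesis
      unfolding Spec_g_Rbar phi_def by (rule imageI)
  qed
  moreover have "bar R M p \<in> phi R gR M ` qp_Spec_g R gR M gM"
    if p: "graded_prime_ideal R gR p" "Ann R M \<subseteq> p" for p
  proof -
    have "p \<subseteq> carrier R" "p \<noteq> carrier R"
      using p(1) additive_subgroup.a_subset[OF ideal.axioms(1)]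
      unfolding graded_prime_ideal_def graded_ideal_def by auto
    \<comment> \<open>For the zero module the annihilator is all of \<open>R\<close>, contradicting
      that \<open>p\<close> is proper. This rules out the disjunct of quasi-primaryfulness that
      provides no \<open>Q\<close>.\<close>
    then have "carrier M \<noteq> {\<zero>\<^bsub>M\<^esub>}"
      using p(2) unfolding Ann_def by auto
    then obtain Q where "Q \<in> qp_Spec_g R gR M gM" "Gr R gR (colon R M Q) = Gr R gR p"
      using assms graded_prime_imp_quasi_primary[OF p(1)] p(2)
      unfolding graded_quasi_primaryful_def by blast
    then show ?thesis
      using Gr_prime[OF p(1)] unfolding phi_def by (metis image_eqI)
  qed
  ultimately show ?thesis
    unfolding Spec_g_Rbar by (intro subset_antisym image_subsetI) (auto simp: Spec_g_def)
qed

text \<open>Membership in the closed set depends on \<open>Q\<close> only through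
  \<open>phi\<close>, so the closed set is a full preimage under \<open>phi\<close>.\<close>

lemma qp_V_g_iff_phi:
  assumes "Q \<in> qp_Spec_g R gR M gM"
  shows "Q \<in> qp_V_g R gR M gM K \<longleftrightarrow> bar R M (Gr R gR (colon R M K)) \<subseteq> phi R gR M Q"
proof -
  have "ideal (Gr R gR (colon R M Q)) R" "Ann R M \<subseteq> Gr R gR (colon R M Q)"
    using Gr_colon_prime[OF assms] Ann_subset_Gr_colon[of Q] assms
    unfolding graded_prime_ideal_def graded_ideal_def qp_Spec_g_def graded_quasi_primary_submodule_def
    by auto
  moreover have "Gr R gR (colon R M K) \<subseteq> carrier R"
    unfolding Gr_def by blast
  ultimately show ?thesis
    unfolding qp_V_g_def phi_def using assms bar_subset_iff by blast
qed

end

theorem theorem3p12: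
  fixes R :: "('a, 'c) ring_scheme" and gR :: "'g::group_add \<Rightarrow> 'a set"
    and M :: "('a, 'b) module" and gM :: "'g \<Rightarrow> 'b set" and K :: "'b set"
  assumes "graded_ring R gR"
    and "graded_module R gR M gM"
    and "graded_quasi_primaryful R gR M gM"
    and "graded_submodule R M gM K"
  shows "phi R gR M ` qp_V_g R gR M gM K
           = V_g (Rbar R M) (gRbar R gR M) (bar R M (Gr R gR (colon R M K)))
         \<and> phi R gR M ` (qp_Spec_g R gR M gM - qp_V_g R gR M gM K)
           = Spec_g (Rbar R M) (gRbar R gR M) - V_g (Rbar R M) (gRbar R gR M) (bar R M (Gr R gR (colon R M K)))"
proof -
  note R = assms(1)[unfolded graded_ring_def] and M = assms(2)[unfolded graded_module_def]
  interpret R: cring R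
    using R by (rule conjunct1)
  interpret M: module R M
    using M by (rule conjunct1)
  interpret graded_module_over_ring R gR M gM
  proof (intro graded_module_over_ring.intro graded_module_over_ring_axioms.intro
      graded_commutative_ring.intro graded_commutative_ring_axioms.intro
      graded_abelian_group.intro graded_abelian_group_axioms.intro
      R.cring_axioms R.abelian_group_axioms M.module_axioms M.abelian_group_axioms)
    show "additive_subgroup (gR g) R" "additive_subgroup (gM g) M" for g
      using R M by simp_all
    show "a \<otimes>\<^bsub>R\<^esub> b \<in> gR (g + h)" if "a \<in> gR g" "b \<in> gR h" for a b g h
      using R that by simp
    show "a \<odot>\<^bsub>M\<^esub> m \<in> gM (g + h)" if "a \<in> gR g" "m \<in> gM h" for a m g h
      using M that by simp
  qed (fact R[THEN conjunct2, THEN conjunct2, THEN conjunct2, THEN bspec]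
      M[THEN conjunct2, THEN conjunct2, THEN conjunct2, THEN bspec])+
  have "qp_V_g R gR M gM K \<subseteq> qp_Spec_g R gR M gM"
    unfolding qp_V_g_def by blast
  then have "qp_V_g R gR M gM K =
      {Q \<in> qp_Spec_g R gR M gM. bar R M (Gr R gR (colon R M K)) \<subseteq> phi R gR M Q}"
    using qp_V_g_iff_phi by (intro subset_antisym subsetI) auto
  \<comment> \<open>For a map onto the spectrum, the image of a full preimage is the original set,
    and the image of its complement is the complement.\<close>
  then show ?thesis
    unfolding V_g_def phi_image_qp_Spec_g[OF assms(3), symmetric] by auto
qed

end
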